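(* Let $m$ be an odd integer such that $q=2m^2+2m+1$ is a prime power. Let $\omega$ be a primitive element of $\mathbb{F}_{q^2}$, $C_i^{(4,q^2)}=\omega^i\langle\omega^4\rangle$ (indices mod 4), $\chi_4$ the multiplicative character of $\mathbb{F}_{q^2}$ with $\chi_4(\omega)=\zeta_4=i$, and $\eta$ the quadratic character of $\mathbb{F}_q$. Let $\epsilon,\delta\in\{1,-1\}$ be such that $G_q(\eta)G_{q^2}(\chi_4)/q=\epsilon m+\delta(m+1)\zeta_4$. Let $h\in\{0,1,2,3\}$ and let $\ell$ be an integer not divisible by $q+1$ with \[ \chi_4(\omega^\ell)=\zeta_4^{3+h},\qquad \chi_4(\omega^{\ell q}-\omega^\ell)=\zeta_4^{\delta(1+2h)}. \] Set $(H_0,H_1)=(\{h,h+1\},\{h+1,h+2\})$ if $\epsilon\delta=1$ and $(H_0,H_1)=(\{h+1,h+2\},\{h,h+1\})$ if $\epsilon\delta=-1$ (indices mod 4), and $D_{\ell,H_d}=\{x\in\mathbb{F}_q: 1+x\omega^\ell\in\bigcup_{j\in H_d}C_j^{(4,q^2)}\}$ for $d=0,1$. Then $|D_{\ell,H_0}|=m^2$, $|D_{\ell,H_1}|=m^2+m$, \[ \{|D_{\ell,H_0}\cap((C_0^{(2,q)}\cup\{0\})+s)|+|D_{\ell,H_1}\cap(C_0^{(2,q)}+s)|: s\in\mathbb{F}_q\}=\{m^2,m^2+m+1\}, \] and \[ \{|D_{\ell,H_0}\cap(C_0^{(2,q)}+s)|+|D_{\ell,H_1}\cap((\mathbb{F}_q^*\setminus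 C_0^{(2,q)})+s)|: s\in\mathbb{F}_q\}=\{m^2-1,m^2,m^2+m-1,m^2+m\}, \] where $C_0^{(2,q)}$ is the set of nonzero squares of $\mathbb{F}_q$.
   Context: For a prime power $Q=p^f$, the canonical additive character of $\mathbb{F}_Q$ is $\psi_{\mathbb{F}_Q}(x)=\exp(2\pi i\,\mathrm{Tr}_{Q/p}(x)/p)$, and for a multiplicative character $\chi$ of $\mathbb{F}_Q$ the Gauss sum is $G_Q(\chi)=\sum_{x\in\mathbb{F}_Q^*}\chi(x)\psi_{\mathbb{F}_Q}(x)$. For $m$ odd, signs $\epsilon,\delta$ as in the claim exist. *)

theory Defs
  imports "HOL-Analysis.Analysis" "HOL-Number_Theory.Prime_Powers"
begin

text \<open>
  All fields live inside one finite ambient field \<open>'a\<close>. If \<open>CARD('a)\<close> is a power of \<open>Q\<close>, the roots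
  of \<open>X^Q - X\<close> form the unique subfield of order \<open>Q\<close>; for \<open>Q = CARD('a)\<close> this is all of \<open>'a\<close>.
\<close>

definition GF :: "nat \<Rightarrow> 'a::{field,finite} set" where
  "GF Q = {x. x ^ Q = x}"

text \<open>The absolute trace from \<open>GF Q\<close> to the prime field, where \<open>Q = p^f\<close> with \<open>p = CHAR('a)\<close>.\<close>

definition abs_trace :: "nat \<Rightarrow> 'a::{field,finite} \<Rightarrow> 'a" where
  "abs_trace Q x = (\<Sum>i<multiplicity CHAR('a) Q. x ^ (CHAR('a) ^ i))"

text \<open>The trace is represented by its unique representative in \<open>{0..<p}\<close>.\<close>

definition canonical_add_char :: "nat \<Rightarrow> 'a::{field,finite} \<Rightarrow> complex" where
  "canonical_add_char Q x =
     exp (2 * of_real pi * \<i> * of_nat (THE k. k < CHAR('a) \<and> of_nat k = abs_trace Q x)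
          / of_nat CHAR('a))"

text \<open>The value at \<open>0\<close> is left unconstrained; it never enters a Gauss sum.\<close>

definition mult_character :: "('a::field \<Rightarrow> complex) \<Rightarrow> bool" where
  "mult_character chi \<longleftrightarrow>
     (\<forall>x. x \<noteq> 0 \<longrightarrow> chi x \<noteq> 0) \<and> (\<forall>x y. x \<noteq> 0 \<longrightarrow> y \<noteq> 0 \<longrightarrow> chi (x * y) = chi x * chi y)"

definition gauss_sum :: "nat \<Rightarrow> ('a::{field,finite} \<Rightarrow> complex) \<Rightarrow> complex" where
  "gauss_sum Q chi = (\<Sum>x\<in>GF Q - {0}. chi x * canonical_add_char Q x)"

definition primitive_element :: "'a::{field,finite} \<Rightarrow> bool" where
  "primitive_element w \<longleftrightarrow> range (\<lambda>n::nat. w ^ n) = UNIV - {0}"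

text \<open>The coset \<open>w^i \<langle>w^N\<rangle>\<close>; for primitive \<open>w\<close> and \<open>N\<close> dividing \<open>CARD('a) - 1\<close> it depends only
  on \<open>i mod N\<close>.\<close>

definition cyclotomic_class :: "'a::{field,finite} \<Rightarrow> nat \<Rightarrow> int \<Rightarrow> 'a set" where
  "cyclotomic_class w N i = range (\<lambda>k::int. w powi i * (w ^ N) powi k)"

definition nonzero_squares :: "nat \<Rightarrow> 'a::{field,finite} set" where
  "nonzero_squares q = (\<lambda>x. x\<^sup>2) ` (GF q - {0})"

definition quadratic_char :: "nat \<Rightarrow> 'a::{field,finite} \<Rightarrow> complex" where
  "quadratic_char q x = (if x = 0 then 0 else if x \<in> nonzero_squares q then 1 else -1)"

definition D_set :: "nat \<Rightarrow> 'a::{field,finite} \<Rightarrow> int \<Rightarrow> int set \<Rightarrow> 'a set" where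
  "D_set q w l H = {x \<in> GF q. 1 + x * w powi l \<in> (\<Union>j\<in>H. cyclotomic_class w 4 j)}"

definition translate :: "'a::plus set \<Rightarrow> 'a \<Rightarrow> 'a set" where
  "translate A s = (\<lambda>x. x + s) ` A"

end

theory Submission
  imports Defs "HOL-Number_Theory.Cong"
begin

text \<open>
  Put \<open>t = \<omega>\<^sup>l\<close> and \<open>F = GF q\<close>. As \<open>q \<equiv> 1 (mod 4)\<close>, \<open>\<chi>\<^sub>4\<close> restricts to \<open>\<eta>\<close> on \<open>F\<close>, so for every \<open>a\<close> the
  function \<open>y \<mapsto> \<chi>\<^sub>4(y) \<eta>(Tr(a y))\<close> is invariant under multiplication by \<open>F - {0}\<close>. Its sum over all
  \<open>y \<noteq> 0\<close> is \<open>(q - 1) J / \<chi>\<^sub>4(a)\<close>, where \<open>J\<close> is the given quotient of Gauss sums, because \<open>G\<^sub>q(\<eta>)\<^sup>2 = q\<close>;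
  on the other hand it is \<open>q - 1\<close> times a sum over the points \<open>t\<close> and \<open>1 + x t\<close> of the projective
  line. Suitable choices of \<open>a\<close> evaluate \<open>\<Sum>\<^sub>x \<chi>\<^sub>4(1 + x t)\<close> and \<open>\<Sum>\<^sub>x \<chi>\<^sub>4(1 + x t) \<eta>(x - s)\<close>.
  The indicator function of two consecutive quartic classes is an affine function of the real and
  imaginary parts of \<open>\<chi>\<^sub>4\<close>, so all cardinalities in question follow from these sums. That all listed
  values occur follows from the class sizes, which need \<open>\<Sum>\<^sub>x \<chi>\<^sub>4(1 + x t)\<^sup>2\<close> in addition.
\<close>

section \<open>Finite fields: characteristic, multiplicative order, prime field\<close>

lemma prime_CHAR_finite_field: "prime CHAR('a::{field,finite})"
  by (intro prime_CHAR_semidom finite_imp_CHAR_pos) simp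

text \<open>Translation by 1 permutes the field, so adding 1 to every element leaves the sum of all
  elements unchanged.\<close>

lemma CHAR_dvd_CARD_finite: "CHAR('a::{field,finite}) dvd CARD('a)"
proof -
  have "(\<Sum>x\<in>(UNIV::'a set). x + 1) = (\<Sum>x\<in>(UNIV::'a set). x)"
    by (rule sum.reindex_bij_witness[of _ "\<lambda>x. x - 1" "\<lambda>x. x + 1"]) auto
  hence "of_nat CARD('a) = (0::'a)"
    by (simp add: sum.distrib)
  thus ?thesis
    by (simp add: of_nat_eq_0_iff_char_dvd)
qed

lemma power_CARD_minus_1:
  fixes x :: "'a::{field,finite}"
  assumes "x \<noteq> 0"
  shows "x ^ (CARD('a) - 1) = 1"
proof -
  have "(\<Prod>y\<in>UNIV-{0}. y) = (\<Prod>y\<in>UNIV-{0}. x * y)"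
    by (rule sym, rule prod.reindex_bij_witness[of _ "\<lambda>y. y / x" "\<lambda>y. x * y"]) (use assms in auto)
  also have "\<dots> = x ^ (CARD('a) - 1) * (\<Prod>y\<in>UNIV-{0}. y)"
    by (simp add: prod.distrib)
  finally show ?thesis
    by simp
qed

text \<open>The images of the naturals below \<open>p\<close> are \<open>p\<close> distinct roots of
  X^p - X, whose degree is \<open>p\<close>, so there are no other roots. This justifies the
  definite description in \<open>canonical_add_char\<close>.\<close>

lemma Frobenius_fixed_eq_of_nat:
  fixes t :: "'a::{field,finite}"
  assumes "t ^ CHAR('a) = t"
  shows "\<exists>!k. k < CHAR('a) \<and> of_nat k = t"
proof -
  define p where "p = CHAR('a)"
  have p: "prime p"
    using prime_CHAR_finite_field[where 'a='a] by (simp add: p_def)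
  hence p2: "2 \<le> p" by (rule prime_ge_2_nat)
  have inj: "inj_on (of_nat :: nat \<Rightarrow> 'a) {..<p}"
    by (auto simp: inj_on_def of_nat_eq_iff_cong_CHAR cong_def p_def)
  define P :: "'a poly" where "P = monom 1 p - monom 1 1"
  have "coeff P p = 1"
    using p2 by (simp add: P_def)
  hence P0: "P \<noteq> 0" by auto
  have deg: "degree P \<le> p"
    unfolding P_def using p2 by (intro degree_diff_le) (auto simp: degree_monom_eq)
  have fix_of_nat: "(of_nat k :: 'a) ^ p = of_nat k" for k
  proof (induction k)
    case 0
    show ?case using p2 by simp
  next
    case (Suc k)
    have "(of_nat k + 1 :: 'a) ^ p = of_nat k ^ p + 1 ^ p"
      using p by (intro freshmans_dream) (auto simp: p_def)
    with Suc show ?case by (simp add: add.commute)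
  qed
  have "of_nat ` {..<p} = {x. poly P x = 0}"
  proof (rule card_subset_eq)
    show "finite {x. poly P x = 0}" by simp
    show sub: "(of_nat ` {..<p} :: 'a set) \<subseteq> {x. poly P x = 0}"
      using fix_of_nat by (auto simp: P_def poly_monom)
    have "card (of_nat ` {..<p} :: 'a set) = p"
      using inj by (simp add: card_image)
    moreover have "card {x. poly P x = 0} \<le> p"
      using card_poly_roots_bound[OF P0] deg by simp
    moreover have "card (of_nat ` {..<p} :: 'a set) \<le> card {x. poly P x = 0}"
      using sub by (intro card_mono) auto
    ultimately show "card (of_nat ` {..<p} :: 'a set) = card {x. poly P x = 0}"
      by simp
  qed
  moreover have "poly P t = 0"
    using assms by (simp add: P_def poly_monom p_def)
  ultimately have "t \<in> of_nat ` {..<p}"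
    by simp
  then obtain k where k: "k < p" "of_nat k = t"
    by auto
  show ?thesis
    unfolding p_def[symmetric]
  proof (rule ex1I[of _ k])
    fix j assume "j < p \<and> of_nat j = t"
    with k inj show "j = k" by (auto simp: inj_on_def)
  qed (use k in auto)
qed

lemma sum_lessThan_add:
  fixes g :: "nat \<Rightarrow> 'b::comm_monoid_add"
  shows "(\<Sum>i<m+n. g i) = (\<Sum>i<m. g i) + (\<Sum>i<n. g (m + i))"
  by (induction n) (simp_all add: ac_simps)

section \<open>A field of order \<open>q^2\<close> over its subfield \<open>F\<close>: conjugation
  and relative trace\<close>

locale quartic_character =
  fixes q :: nat and w :: "'a::{field,finite}" and chi :: "'a \<Rightarrow> complex"
  assumes q_mod_4: "q mod 4 = 1"
    and primepow_q: "primepow q"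
    and card_UNIV_eq: "CARD('a) = q\<^sup>2"
    and primitive: "primitive_element w"
    and mult_character_chi: "mult_character chi"
    and chi_w: "chi w = \<i>"
begin

abbreviation F :: "'a set" where "F \<equiv> GF q"
abbreviation eta :: "'a \<Rightarrow> complex" where "eta \<equiv> quadratic_char q"
abbreviation psi :: "'a \<Rightarrow> complex" where "psi \<equiv> canonical_add_char q"
abbreviation Tr :: "'a \<Rightarrow> 'a" where "Tr y \<equiv> y + y ^ q"

lemma q_gt_1: "q > 1"
  using primepow_gt_Suc_0[OF primepow_q] by simp

lemma odd_q: "odd q"
  using q_mod_4 by presburger

text \<open>The two multiplicities are the numbers of summands of the absolute traces from
  \<open>GF q\<close> and from \<open>GF (q^2)\<close>.\<close>

lemma q_CHAR_power:
  obtains f where "q = CHAR('a) ^ f" "multiplicity CHAR('a) q = f"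
    "multiplicity CHAR('a) (q\<^sup>2) = 2 * f"
proof -
  obtain r k where r: "prime r" "k > 0" "q = r ^ k"
    using primepow_q unfolding primepow_def by auto
  have "CHAR('a) dvd r ^ (k * 2)"
    using CHAR_dvd_CARD_finite[where 'a='a] by (simp add: card_UNIV_eq r power_mult)
  hence "CHAR('a) dvd r"
    using prime_CHAR_finite_field[where 'a='a] by (metis prime_dvd_power)
  hence "CHAR('a) = r"
    using r prime_CHAR_finite_field[where 'a='a] by (simp add: primes_dvd_imp_eq)
  moreover from this have "multiplicity CHAR('a) q = k" "multiplicity CHAR('a) (q\<^sup>2) = 2 * k"
    using r by (simp_all add: multiplicity_same_power flip: power_mult)
  ultimately show thesis
    using r that by simp
qed

text \<open>Raising to the power \<open>q\<close> is an iterate of Frobenius. It is the conjugation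
  of the quadratic extension over \<open>F\<close>, which makes \<open>Tr\<close> the relative
  trace.\<close>

lemma conj_add: "(x + y) ^ q = x ^ q + y ^ q" for x y :: 'a
proof -
  obtain f where "q = CHAR('a) ^ f" using q_CHAR_power by blast
  thus ?thesis by (rule freshmans_dream'[OF prime_CHAR_finite_field])
qed

lemma conj_minus: "(- x) ^ q = - (x ^ q)" for x :: 'a
  using odd_q by simp

lemma conj_diff: "(x - y) ^ q = x ^ q - y ^ q" for x y :: 'a
  using conj_add[of x "- y"] by (simp add: conj_minus)

lemma power_q2: "x ^ (q * q) = x" for x :: 'a
proof (cases "x = 0")
  case False
  have "x ^ (q * q) = x ^ Suc (CARD('a) - 1)"
    using q_gt_1 by (simp add: card_UNIV_eq power2_eq_square)
  also have "\<dots> = x"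
    by (simp only: power_Suc power_CARD_minus_1[OF False] mult_1_right)
  finally show ?thesis .
qed (use q_gt_1 in auto)

lemma conj_conj: "(x ^ q) ^ q = x" for x :: 'a
  by (simp add: power_q2 flip: power_mult)

lemma GF_q2: "GF (q\<^sup>2) = (UNIV :: 'a set)"
  by (simp add: GF_def power2_eq_square power_q2)

lemma GF_simps [simp, intro]:
  "0 \<in> F" "1 \<in> F"
  "x \<in> F \<Longrightarrow> y \<in> F \<Longrightarrow> x + y \<in> F"
  "x \<in> F \<Longrightarrow> y \<in> F \<Longrightarrow> x - y \<in> F"
  "x \<in> F \<Longrightarrow> - x \<in> F"
  "x \<in> F \<Longrightarrow> y \<in> F \<Longrightarrow> x * y \<in> F"
  "x \<in> F \<Longrightarrow> y \<in> F \<Longrightarrow> x / y \<in> F"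
  "Tr z \<in> F"
  using q_gt_1
  by (auto simp: GF_def conj_add conj_diff conj_minus power_mult_distrib power_divide conj_conj)

lemma Tr_mult: "c \<in> F \<Longrightarrow> Tr (c * y) = c * Tr y"
  by (simp add: GF_def power_mult_distrib algebra_simps)

subsection \<open>The additive character\<close>

lemma abs_trace_add: "abs_trace Q (x + y) = abs_trace Q x + abs_trace Q (y :: 'a)"
proof -
  have "(x + y) ^ (CHAR('a) ^ i) = x ^ (CHAR('a) ^ i) + y ^ (CHAR('a) ^ i)" for i
    by (rule freshmans_dream'[OF prime_CHAR_finite_field refl])
  thus ?thesis by (simp add: abs_trace_def sum.distrib)
qed

text \<open>Frobenius shifts the summands cyclically, because x^q = x returns the last one to the
  first. Hence the trace lies in the prime field.\<close>

lemma abs_trace_Frobenius_fixed: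
  assumes "x \<in> F"
  shows "abs_trace q x ^ CHAR('a) = abs_trace q x"
proof -
  obtain f where f: "q = CHAR('a) ^ f" "multiplicity CHAR('a) q = f"
    using q_CHAR_power by blast
  let ?g = "\<lambda>i. x ^ (CHAR('a) ^ i)"
  have "abs_trace q x ^ CHAR('a) = (\<Sum>i<f. ?g i ^ CHAR('a))"
    unfolding abs_trace_def f(2) by (rule freshmans_dream_sum[OF prime_CHAR_finite_field refl])
  also have "\<dots> = (\<Sum>i<f. ?g (Suc i))"
    by (simp add: mult.commute flip: power_mult)
  also have "\<dots> = (\<Sum>i<Suc f. ?g i) - ?g 0"
    by (subst sum.lessThan_Suc_shift) simp
  also have "\<dots> = (\<Sum>i<f. ?g i)"
    using assms f(1) by (simp add: GF_def)
  also have "\<dots> = abs_trace q x"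
    by (simp add: abs_trace_def f(2))
  finally show ?thesis .
qed

lemma psi_add:
  assumes "x \<in> F" "y \<in> F"
  shows "psi (x + y) = psi x * psi y"
proof -
  define p where "p = CHAR('a)"
  have p: "p > 0"
    using prime_CHAR_finite_field[where 'a='a] by (simp add: p_def prime_gt_0_nat)
  define E :: "nat \<Rightarrow> complex" where "E k = exp (2 * of_real pi * \<i> * of_nat k / of_nat p)" for k
  have E_add: "E (j + k) = E j * E k" for j k
    by (simp add: E_def add_divide_distrib ring_distribs exp_add)
  have "E p = 1"
    using p by (simp add: E_def)
  hence E_mult: "E (p * k) = 1" for k
    by (induction k) (auto simp: E_add, simp add: E_def)
  \<comment> \<open>\<open>E\<close> sees only residues modulo \<open>p\<close>, which is enough
    because the representatives \<open>T\<close> add up only modulo \<open>p\<close>.\<close>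
  have E_mod: "E (k mod p) = E k" for k
    using E_add[of "p * (k div p)" "k mod p"] by (simp add: E_mult)
  define T where "T z = (THE k. k < CHAR('a) \<and> of_nat k = abs_trace q z)" for z :: 'a
  \<comment> \<open>For z in \<open>F\<close> the trace lies in the prime field, so the description
    denotes.\<close>
  have T: "of_nat (T z) = abs_trace q z" if "z \<in> F" for z
    using theI'[OF Frobenius_fixed_eq_of_nat[OF abs_trace_Frobenius_fixed[OF that]]]
    by (simp add: T_def)
  have "of_nat (T (x + y)) = (of_nat (T x + T y) :: 'a)"
    using assms by (simp add: T abs_trace_add)
  hence "T (x + y) mod p = (T x + T y) mod p"
    by (simp only: of_nat_eq_iff_cong_CHAR cong_def p_def)
  hence "E (T (x + y)) = E (T x) * E (T y)"
    by (metis E_mod E_add)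
  moreover have "psi z = E (T z)" for z
    by (simp add: canonical_add_char_def E_def T_def p_def)
  ultimately show ?thesis by simp
qed

lemma psi_nonzero: "psi x \<noteq> 0"
  by (simp add: canonical_add_char_def)

text \<open>Transitivity of the trace: of the 2f Frobenius conjugates of \<open>y\<close>, the upper
  f are the lower f conjugates of \<open>y ^ q\<close>.\<close>

lemma canonical_add_char_q2: "canonical_add_char (q\<^sup>2) y = psi (Tr y)"
proof -
  obtain f where f: "q = CHAR('a) ^ f" "multiplicity CHAR('a) q = f"
    "multiplicity CHAR('a) (q\<^sup>2) = 2 * f"
    using q_CHAR_power by blast
  have "abs_trace (q\<^sup>2) y = (\<Sum>i<f+f. y ^ (CHAR('a) ^ i))"
    by (simp add: abs_trace_def f(3) mult_2)
  also have "\<dots> = (\<Sum>i<f. y ^ (CHAR('a) ^ i)) + (\<Sum>i<f. y ^ (CHAR('a) ^ (f + i)))"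
    by (rule sum_lessThan_add)
  also have "\<dots> = abs_trace q y + abs_trace q (y ^ q)"
    unfolding abs_trace_def f(2) by (simp add: power_add power_mult flip: f(1))
  finally show ?thesis
    by (simp add: canonical_add_char_def abs_trace_add)
qed

subsection \<open>The quartic and the quadratic character\<close>

lemma w_nonzero: "w \<noteq> 0"
  using primitive unfolding primitive_element_def
  by (metis Diff_iff insertI1 power_one_right rangeI)

lemma nonzero_eq_power:
  assumes "y \<noteq> 0"
  obtains n where "y = w ^ n"
  using primitive assms unfolding primitive_element_def by blast

text \<open>The exponents below \<open>q^2 - 1\<close> already reach all \<open>q^2 - 1\<close>
  nonzero elements, so these powers are distinct.\<close>

lemma w_power_eq_1_iff: "w ^ n = 1 \<longleftrightarrow> (q\<^sup>2 - 1) dvd n"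
proof -
  define N where "N = q\<^sup>2 - 1"
  have "q\<^sup>2 > 1" using q_gt_1 by (intro one_less_power) auto
  hence N: "N > 0" by (simp add: N_def)
  have wN: "w ^ N = 1"
    using power_CARD_minus_1[OF w_nonzero] by (simp add: card_UNIV_eq N_def)
  have mod: "w ^ (n mod N) = w ^ n" for n
  proof -
    have "w ^ n = w ^ (N * (n div N) + n mod N)" by simp
    also have "\<dots> = w ^ (n mod N)" by (simp only: power_add power_mult wN power_one mult_1_left)
    finally show ?thesis by simp
  qed
  have "(\<lambda>n. w ^ n) ` {..<N} = range (\<lambda>n. w ^ n)"
    using N by (auto simp: image_iff) (metis mod lessThan_iff mod_less_divisor)
  hence "card ((\<lambda>n. w ^ n) ` {..<N}) = card {..<N}"
    using primitive by (simp add: primitive_element_def card_UNIV_eq N_def)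
  hence inj: "inj_on (\<lambda>n. w ^ n) {..<N}"
    by (intro eq_card_imp_inj_on) auto
  show ?thesis
  proof
    assume "w ^ n = 1"
    hence "w ^ (n mod N) = w ^ 0" by (simp add: mod)
    hence "n mod N = 0" using inj N by (intro inj_onD[OF inj]) auto
    thus "(q\<^sup>2 - 1) dvd n" by (simp add: N_def mod_eq_0_iff_dvd)
  next
    assume "(q\<^sup>2 - 1) dvd n"
    then obtain k where "n = N * k" unfolding N_def by (rule dvdE)
    thus "w ^ n = 1" by (simp add: power_mult wN)
  qed
qed

lemma w_powi_eq_1D:
  assumes "w powi k = 1"
  shows "int (q\<^sup>2 - 1) dvd k"
proof (cases "k \<ge> 0")
  case True
  with assms have "w ^ nat k = 1" by (simp add: power_int_def)
  hence "int (q\<^sup>2 - 1) dvd int (nat k)" by (simp only: w_power_eq_1_iff int_dvd_int_iff)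
  with True show ?thesis by simp
next
  case False
  with assms have "w ^ nat (- k) = 1" by (simp add: power_int_def power_inverse)
  hence "int (q\<^sup>2 - 1) dvd int (nat (- k))" by (simp only: w_power_eq_1_iff int_dvd_int_iff)
  with False show ?thesis by simp
qed

lemma chi_mult: "x \<noteq> 0 \<Longrightarrow> y \<noteq> 0 \<Longrightarrow> chi (x * y) = chi x * chi y"
  and chi_nonzero: "x \<noteq> 0 \<Longrightarrow> chi x \<noteq> 0"
  using mult_character_chi unfolding mult_character_def by auto

lemma chi_1 [simp]: "chi 1 = 1"
  using chi_mult[of 1 1] chi_nonzero[of 1] by simp

lemma chi_power: "y \<noteq> 0 \<Longrightarrow> chi (y ^ n) = chi y ^ n"
  by (induction n) (auto simp: chi_mult)

lemma chi_inverse: "y \<noteq> 0 \<Longrightarrow> chi (inverse y) = inverse (chi y)"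
  using chi_mult[of y "inverse y"] chi_nonzero[of y] by (simp add: field_simps)

lemma chi_divide: "x \<noteq> 0 \<Longrightarrow> y \<noteq> 0 \<Longrightarrow> chi (x / y) = chi x / chi y"
  by (simp add: divide_inverse chi_mult chi_inverse)

lemma chi_w_powi: "chi (w powi k) = \<i> powi k"
  using w_nonzero by (simp add: power_int_def chi_power chi_inverse chi_w)

text \<open>\<open>chi\<close> depends only on the exponent of \<open>w\<close> modulo 4, and
  multiplication by \<open>q\<close> preserves that residue.\<close>

lemma chi_conj: "y \<noteq> 0 \<Longrightarrow> chi (y ^ q) = chi y"
proof -
  assume y: "y \<noteq> 0"
  then obtain n where n: "y = w ^ n" by (rule nonzero_eq_power)
  have "q = 4 * (q div 4) + 1" using q_mod_4 by presburger
  hence "\<i> ^ q = \<i> ^ (4 * (q div 4) + 1)" by simp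
  hence "\<i> ^ q = \<i>" by (simp add: power_add power_mult)
  thus ?thesis using w_nonzero by (simp add: n chi_power chi_w) (metis mult.commute power_mult)
qed

lemma chi_cases: "y \<noteq> 0 \<Longrightarrow> chi y \<in> {1, \<i>, -1, -\<i>}"
proof -
  assume "y \<noteq> 0"
  then obtain n where n: "y = w ^ n" by (rule nonzero_eq_power)
  have "\<i> ^ n \<in> {1, \<i>, -1, -\<i>}" by (induction n) auto
  thus ?thesis using w_nonzero by (simp add: n chi_power chi_w)
qed

lemma eight_dvd: "8 dvd q\<^sup>2 - 1"
proof -
  have "q = 4 * (q div 4) + 1" using q_mod_4 by presburger
  then obtain j where "q = 4 * j + 1" by blast
  hence "q\<^sup>2 - 1 = 8 * (2 * j\<^sup>2 + j)" by (simp add: power2_eq_square algebra_simps)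
  thus ?thesis by simp
qed

text \<open>The element -1 is \<open>w\<close> to the power \<open>(q^2 - 1) / 2\<close>, and by
  \<open>eight_dvd\<close> this exponent is a multiple of 4.\<close>

lemma chi_minus_1: "chi (- 1) = 1"
proof -
  obtain k where k: "q\<^sup>2 - 1 = 8 * k" using eight_dvd by (rule dvdE)
  have "q\<^sup>2 > 1" using q_gt_1 by (intro one_less_power) auto
  hence k0: "k > 0" using k by (cases k) auto
  have "(w ^ (4 * k))\<^sup>2 = w ^ (8 * k)" by (simp flip: power_mult)
  also have "\<dots> = 1" using k by (simp add: w_power_eq_1_iff)
  finally have "w ^ (4 * k) = 1 \<or> w ^ (4 * k) = -1" by (simp add: power2_eq_1_iff)
  moreover have "w ^ (4 * k) \<noteq> 1"
    using k0 unfolding w_power_eq_1_iff k by (auto dest: dvd_imp_le)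
  ultimately have "- 1 = w ^ (4 * k)" by simp
  thus ?thesis using w_nonzero by (simp add: chi_power chi_w power_mult)
qed

lemma chi_minus: "y \<noteq> 0 \<Longrightarrow> chi (- y) = chi y"
  using chi_mult[of "-1" y] by (simp add: chi_minus_1)

lemma mem_cyclotomic_class_iff:
  assumes "y \<noteq> 0"
  shows "y \<in> cyclotomic_class w 4 j \<longleftrightarrow> chi y = \<i> powi j"
proof
  assume "y \<in> cyclotomic_class w 4 j"
  then obtain k where "y = w powi j * (w ^ 4) powi k"
    by (auto simp: cyclotomic_class_def)
  also have "(w ^ 4) powi k = w powi (4 * k)"
    by (simp add: power_int_mult)
  finally have "chi y = \<i> powi j * \<i> powi (4 * k)"
    using w_nonzero by (simp add: chi_mult chi_w_powi)
  also have "\<i> powi (4 * k) = 1"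
    by (simp add: power_int_mult)
  finally show "chi y = \<i> powi j" by simp
next
  assume eq: "chi y = \<i> powi j"
  obtain n where n: "y = w ^ n" using assms by (rule nonzero_eq_power)
  have "\<i> powi (int n) = \<i> powi j"
    using eq w_nonzero by (simp add: n chi_power chi_w)
  hence 1: "\<i> powi (int n - j) = 1"
    by (simp add: power_int_diff)
  define r where "r = (int n - j) mod 4"
  define k where "k = (int n - j) div 4"
  have nj: "int n - j = 4 * k + r" by (simp add: r_def k_def)
  have "\<i> powi (4 * k) = 1"
    by (simp add: power_int_mult)
  hence "\<i> powi r = 1"
    using 1 by (simp add: nj power_int_add)
  moreover have "r \<in> {0, 1, 2, 3}" by (auto simp: r_def)
  ultimately have "r = 0" by (auto simp: power_int_def numeral_eq_Suc complex_eq_iff)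
  hence "int n = j + 4 * k" using nj by simp
  hence "w powi (int n) = w powi j * (w ^ 4) powi k"
    using w_nonzero by (simp add: power_int_add power_int_mult)
  thus "y \<in> cyclotomic_class w 4 j"
    by (auto simp: cyclotomic_class_def n)
qed

section \<open>The cyclic group \<open>F - {0}\<close> and the quadratic character on it\<close>

lemma q2_factor: "q\<^sup>2 - 1 = (q + 1) * (q - 1)"
  by (simp add: power2_eq_square algebra_simps)

lemma w_power_mem_GF: "w ^ ((q + 1) * k) \<in> F"
proof -
  have "(w ^ (q + 1)) ^ q = w ^ (q + q * q)"
    by (simp only: power_mult [symmetric] distrib_right mult_1_left add.commute)
  also have "\<dots> = w ^ (q + 1)"
    by (simp add: power_add power_q2)
  finally show ?thesis
    by (simp only: GF_def mem_Collect_eq) (metis power_mult mult.commute)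
qed

text \<open>For x = w^n the equation x^q = x means that n (q - 1) is a multiple of (q + 1) (q - 1).
  So \<open>w ^ (q + 1)\<close> generates the multiplicative group of \<open>F\<close>.\<close>

lemma GF_nonzero_eq: "F - {0} = (\<lambda>k. w ^ ((q + 1) * k)) ` {..<q - 1}"
proof (intro equalityI subsetI)
  fix x assume "x \<in> F - {0}"
  hence x: "x ^ q = x" "x \<noteq> 0" by (auto simp: GF_def)
  obtain n where n: "x = w ^ n" using x(2) by (rule nonzero_eq_power)
  have "w ^ n * w ^ (n * (q - 1)) = w ^ (n * q)"
    using q_gt_1 by (simp add: algebra_simps flip: power_add)
  also have "\<dots> = w ^ n * 1" using x by (simp add: n power_mult)
  finally have "w ^ (n * (q - 1)) = 1" using w_nonzero by simp
  hence "(q + 1) * (q - 1) dvd n * (q - 1)" by (simp only: w_power_eq_1_iff q2_factor)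
  hence "q + 1 dvd n" using q_gt_1 by (subst (asm) dvd_times_right_cancel_iff) auto
  then obtain k where k: "n = (q + 1) * k" by (rule dvdE)
  have "w ^ ((q + 1) * (q - 1)) = 1"
    by (simp only: w_power_eq_1_iff q2_factor dvd_refl)
  hence one: "(w ^ (q + 1)) ^ (q - 1) = 1" by (simp only: power_mult)
  have "x = (w ^ (q + 1)) ^ ((q - 1) * (k div (q - 1)) + k mod (q - 1))"
    by (simp only: n k power_mult mult_div_mod_eq)
  also have "\<dots> = w ^ ((q + 1) * (k mod (q - 1)))"
    by (simp only: power_add[of "w ^ (q + 1)"] power_mult one power_one mult_1_left)
  finally show "x \<in> (\<lambda>k. w ^ ((q + 1) * k)) ` {..<q - 1}"
    using q_gt_1 by auto
next
  fix x assume "x \<in> (\<lambda>k. w ^ ((q + 1) * k)) ` {..<q - 1}"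
  thus "x \<in> F - {0}" using w_nonzero w_power_mem_GF by auto
qed

lemma card_GF: "card F = q"
proof -
  have "inj_on (\<lambda>k. w ^ ((q + 1) * k)) {..<q - 1}"
  proof (rule linorder_inj_onI)
    fix j k assume jk: "j < k" "j \<in> {..<q - 1}" "k \<in> {..<q - 1}"
    show "w ^ ((q + 1) * j) \<noteq> w ^ ((q + 1) * k)"
    proof
      assume "w ^ ((q + 1) * j) = w ^ ((q + 1) * k)"
      also have "(q + 1) * k = (q + 1) * j + (q + 1) * (k - j)"
        using jk by (simp flip: distrib_left)
      finally have "w ^ ((q + 1) * (k - j)) = 1"
        using w_nonzero by (simp only: power_add) simp
      hence "(q + 1) * (q - 1) dvd (q + 1) * (k - j)"
        by (simp only: w_power_eq_1_iff q2_factor)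
      hence "q - 1 dvd k - j" by (simp del: mult_Suc)
      thus False using jk by (auto dest: dvd_imp_le)
    qed
  qed auto
  hence "card (F - {0}) = q - 1"
    by (simp only: GF_nonzero_eq card_image card_lessThan)
  thus ?thesis using q_gt_1 by (simp add: card_Diff_subset)
qed

text \<open>Since q + 1 is 2 modulo 4, \<open>chi\<close> is -1 on the generator of
  \<open>F - {0}\<close>. This is why \<open>chi\<close> restricts to \<open>eta\<close>.\<close>

lemma chi_w_power_GF: "chi (w ^ ((q + 1) * k)) = (-1) ^ k"
proof -
  have "q + 1 = 4 * (q div 4) + 2" using q_mod_4 by presburger
  hence "\<i> ^ (q + 1) = \<i> ^ (4 * (q div 4) + 2)" by simp
  also have "\<dots> = -1" by (simp add: power_add power_mult)
  finally have "\<i> ^ (q + 1) = -1" .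
  thus ?thesis 
    by (simp only: power_mult chi_power[OF power_not_zero[OF w_nonzero]] chi_power[OF w_nonzero] chi_w)
qed

text \<open>Being a square and having \<open>chi x = 1\<close> both amount to an even exponent with
  respect to the generator \<open>w ^ (q + 1)\<close>.\<close>

lemma nonzero_squares_iff:
  assumes "x \<in> F" "x \<noteq> 0"
  shows "x \<in> nonzero_squares q \<longleftrightarrow> chi x = 1" and "chi x \<in> {1, -1}"
proof -
  obtain k where x: "x = w ^ ((q + 1) * k)"
    using assms GF_nonzero_eq by blast
  have chi_x: "chi x = (-1) ^ k"
    by (simp only: x chi_w_power_GF)
  show "chi x \<in> {1, -1}"
    by (simp add: chi_x minus_one_power_iff)
  show "x \<in> nonzero_squares q \<longleftrightarrow> chi x = 1"
  proof
    assume "x \<in> nonzero_squares q"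
    then obtain z where z: "z \<in> F" "z \<noteq> 0" "x = z\<^sup>2" by (auto simp: nonzero_squares_def)
    then obtain j where "z = w ^ ((q + 1) * j)" using GF_nonzero_eq by blast
    hence "chi z = (-1) ^ j"
      by (simp only: chi_w_power_GF)
    thus "chi x = 1" using z by (simp add: chi_power flip: power_mult)
  next
    assume "chi x = 1"
    hence "even k" by (simp add: chi_x minus_one_power_iff split: if_splits)
    then obtain j where j: "k = 2 * j" by (rule evenE)
    have "x = (w ^ ((q + 1) * j))\<^sup>2"
      by (simp only: x j power_mult [symmetric] mult_ac)
    moreover have "w ^ ((q + 1) * j) \<in> F - {0}"
      using w_nonzero w_power_mem_GF[of j] by simp
    ultimately show "x \<in> nonzero_squares q"
      unfolding nonzero_squares_def by (rule image_eqI)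
  qed
qed

lemma nonzero_squares_subset: "nonzero_squares q \<subseteq> F - {0}"
  by (auto simp: nonzero_squares_def power2_eq_square)

lemma eta_0 [simp]: "eta 0 = 0"
  by (simp add: quadratic_char_def)

lemma eta_eq_chi: "x \<in> F \<Longrightarrow> x \<noteq> 0 \<Longrightarrow> eta x = chi x"
  using nonzero_squares_iff[of x] by (auto simp: quadratic_char_def)

lemma eta_square: "x \<in> F \<Longrightarrow> x \<noteq> 0 \<Longrightarrow> eta x * eta x = 1"
  by (auto simp: quadratic_char_def)

lemma eta_mult: "x \<in> F \<Longrightarrow> y \<in> F \<Longrightarrow> eta (x * y) = eta x * eta y"
  by (cases "x = 0"; cases "y = 0") (auto simp: eta_eq_chi chi_mult)

lemma sum_GF_mult:
  fixes g :: "'a \<Rightarrow> 'b::comm_monoid_add"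
  assumes "c \<in> F" "c \<noteq> 0"
  shows "(\<Sum>x\<in>F. g (c * x)) = (\<Sum>x\<in>F. g x)"
  by (rule sum.reindex_bij_witness[of _ "\<lambda>x. x / c" "\<lambda>x. c * x"]) (use assms in auto)

lemma sum_GF_add:
  fixes g :: "'a \<Rightarrow> 'b::comm_monoid_add"
  assumes "c \<in> F"
  shows "(\<Sum>x\<in>F. g (x + c)) = (\<Sum>x\<in>F. g x)"
  by (rule sum.reindex_bij_witness[of _ "\<lambda>x. x - c" "\<lambda>x. x + c"]) (use assms in auto)

text \<open>Multiplication by the nonsquare \<open>w ^ (q + 1)\<close> permutes \<open>F\<close> and
  negates the sum.\<close>

lemma sum_eta: "(\<Sum>x\<in>F. eta x) = 0"
proof -
  have g: "w ^ (q + 1) \<in> F" "w ^ (q + 1) \<noteq> 0"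
    using w_power_mem_GF[of 1] w_nonzero by simp_all
  have "eta (w ^ (q + 1)) = -1"
    using chi_w_power_GF[of 1] by (simp only: eta_eq_chi[OF g]) simp
  hence "(\<Sum>x\<in>F. eta (w ^ (q + 1) * x)) = - (\<Sum>x\<in>F. eta x)"
    using g(1) by (simp only: sum_negf[symmetric]) (simp add: eta_mult)
  thus ?thesis using sum_GF_mult[OF g, of eta] by simp
qed

subsection \<open>Gauss sums\<close>

lemma sum_psi:
  assumes "a \<in> F" "psi a \<noteq> 1"
  shows "(\<Sum>x\<in>F. psi x) = 0"
proof -
  have "(\<Sum>x\<in>F. psi x) = (\<Sum>x\<in>F. psi (x + a))"
    by (rule sum_GF_add[OF assms(1), symmetric])
  also have "\<dots> = (\<Sum>x\<in>F. psi x) * psi a"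
    using assms(1) by (simp add: psi_add sum_distrib_right)
  finally show ?thesis
    using assms(2) by simp
qed

lemma psi_0: "psi 0 = 1"
  using psi_add[of 0 0] psi_nonzero[of 0] by simp

lemma gauss_sum_eta: "gauss_sum q eta = (\<Sum>x\<in>F. eta x * psi x)"
  unfolding gauss_sum_def by (rule sum.mono_neutral_left) auto

text \<open>Substitute \<open>t * c\<close> for the summation variable; at \<open>t = 0\<close> both
  sides vanish by \<open>sum_eta\<close>.\<close>

lemma gauss_sum_twist:
  assumes "t \<in> F"
  shows "(\<Sum>c\<in>F. eta c * psi (c * t)) = eta t * gauss_sum q eta"
proof (cases "t = 0")
  case True
  thus ?thesis by (simp add: psi_0 sum_eta)
next
  case False
  have "eta t * gauss_sum q eta = eta t * (\<Sum>c\<in>F. eta (t * c) * psi (t * c))"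
    by (simp only: gauss_sum_eta sum_GF_mult[OF assms False, of "\<lambda>x. eta x * psi x"])
  also have "\<dots> = (\<Sum>c\<in>F. (eta t * eta t) * (eta c * psi (c * t)))"
    using assms by (simp add: sum_distrib_left eta_mult mult_ac)
  also have "\<dots> = (\<Sum>c\<in>F. eta c * psi (c * t))"
    by (simp only: eta_square[OF assms False] mult_1_left)
  finally show ?thesis by simp
qed

text \<open>The hypothesis supplies the nontriviality of \<open>psi\<close>: with \<open>psi\<close>
  constantly 1 on \<open>F\<close> the Gauss sum would reduce to \<open>sum_eta\<close>. In the
  expanded square only the terms with c = -1 survive, and \<open>eta (-1) = 1\<close>.\<close>

lemma gauss_sum_eta_square:
  assumes "gauss_sum q eta \<noteq> 0"
  shows "gauss_sum q eta * gauss_sum q eta = of_nat q"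
proof -
  have "\<exists>a\<in>F. psi a \<noteq> 1"
  proof (rule ccontr)
    assume "\<not> ?thesis"
    hence "gauss_sum q eta = (\<Sum>x\<in>F. eta x)"
      by (simp add: gauss_sum_eta)
    with assms sum_eta show False by simp
  qed
  hence sum0: "(\<Sum>x\<in>F. psi x) = 0"
    using sum_psi by blast
  have inner: "(\<Sum>x\<in>F. psi ((1 + c) * x)) = (if c = -1 then of_nat q else 0)" if "c \<in> F" for c
  proof (cases "c = -1")
    case True
    thus ?thesis by (simp add: psi_0 card_GF)
  next
    case False
    hence "1 + c \<noteq> 0" by (metis add_eq_0_iff)
    thus ?thesis using sum_GF_mult[of "1 + c" psi] that sum0 False by simp
  qed
  have "gauss_sum q eta * gauss_sum q eta = (\<Sum>x\<in>F. psi x * (eta x * gauss_sum q eta))"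
    by (subst (1) gauss_sum_eta) (simp add: sum_distrib_left mult_ac)
  also have "\<dots> = (\<Sum>x\<in>F. psi x * (\<Sum>c\<in>F. eta c * psi (c * x)))"
    by (simp add: gauss_sum_twist)
  also have "\<dots> = (\<Sum>x\<in>F. \<Sum>c\<in>F. eta c * psi ((1 + c) * x))"
    by (simp add: sum_distrib_left ring_distribs psi_add mult_ac)
  also have "\<dots> = (\<Sum>c\<in>F. eta c * (\<Sum>x\<in>F. psi ((1 + c) * x)))"
    by (subst sum.swap) (simp add: sum_distrib_left)
  also have "\<dots> = (\<Sum>c\<in>F. if c = -1 then eta (-1) * of_nat q else 0)"
    by (intro sum.cong) (auto simp: inner)
  also have "\<dots> = eta (-1) * of_nat q"
    by simp
  also have "eta (-1) = 1"
    using eta_eq_chi[of "-1"] by (simp add: chi_minus_1)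
  finally show ?thesis by simp
qed

text \<open>The parameter \<open>a\<close> selects an \<open>F\<close>-linear functional to
  \<open>F\<close>. By \<open>gauss_sum_q2_eq\<close>, \<open>K 1\<close> is q - 1 times the
  quotient of the Gauss sums of \<open>chi\<close> and \<open>eta\<close> whenever the latter is
  nonzero.\<close>

definition K :: "'a \<Rightarrow> complex" where
  "K a = (\<Sum>y\<in>UNIV-{0}. chi y * eta (Tr (a * y)))"

text \<open>Substituting \<open>a * y\<close> moves \<open>a\<close> out of the functional and into
  \<open>chi\<close>, so the functional may be chosen freely.\<close>

lemma K_eq: "a \<noteq> 0 \<Longrightarrow> K a = K 1 / chi a"
proof -
  assume a: "a \<noteq> 0"
  have "K 1 = (\<Sum>y\<in>UNIV-{0}. chi (a * y) * eta (Tr (a * y)))"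
    unfolding K_def
    by (rule sum.reindex_bij_witness[of _ "\<lambda>y. a * y" "\<lambda>y. y / a"]) (use a in auto)
  also have "\<dots> = chi a * K a"
    using a by (simp add: K_def sum_distrib_left chi_mult mult_ac)
  finally show ?thesis using chi_nonzero[OF a] by (simp add: field_simps)
qed

text \<open>Replacing \<open>y\<close> by \<open>c * y\<close> and averaging over \<open>c \<in> F - {0}\<close> splits the big Gauss sum
  into a quadratic Gauss sum over \<open>F\<close> and a sum without additive characters.\<close>

lemma gauss_sum_q2_eq: "of_nat (q - 1) * gauss_sum (q\<^sup>2) chi = K 1 * gauss_sum q eta"
proof -
  have "of_nat (q - 1) * gauss_sum (q\<^sup>2) chi
      = (\<Sum>c\<in>F-{0}. \<Sum>y\<in>UNIV-{0}. chi y * psi (Tr y))"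
    by (simp add: gauss_sum_def GF_q2 canonical_add_char_q2 card_Diff_subset card_GF)
  also have "\<dots> = (\<Sum>c\<in>F-{0}. \<Sum>y\<in>UNIV-{0}. chi (c * y) * psi (Tr (c * y)))"
  proof (rule sum.cong[OF refl])
    fix c assume "c \<in> F - {0}"
    thus "(\<Sum>y\<in>UNIV-{0}. chi y * psi (Tr y)) = (\<Sum>y\<in>UNIV-{0}. chi (c * y) * psi (Tr (c * y)))"
      by (intro sum.reindex_bij_witness[of _ "\<lambda>y. c * y" "\<lambda>y. y / c"]) auto
  qed
  also have "\<dots> = (\<Sum>c\<in>F-{0}. \<Sum>y\<in>UNIV-{0}. chi y * (eta c * psi (c * Tr y)))"
    by (intro sum.cong refl) (simp add: eta_eq_chi chi_mult Tr_mult)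
  also have "\<dots> = (\<Sum>y\<in>UNIV-{0}. chi y * (\<Sum>c\<in>F-{0}. eta c * psi (c * Tr y)))"
    by (subst sum.swap) (simp only: sum_distrib_left)
  also have "\<dots> = (\<Sum>y\<in>UNIV-{0}. chi y * (\<Sum>c\<in>F. eta c * psi (c * Tr y)))"
    by (intro sum.cong refl arg_cong2[where f="(*)"] sum.mono_neutral_left) auto
  also have "\<dots> = K 1 * gauss_sum q eta"
    by (simp add: gauss_sum_twist K_def sum_distrib_left mult_ac)
  finally show ?thesis .
qed

text \<open>A nonzero \<open>J\<close> forces a nonzero quadratic Gauss sum. Its square is then
  \<open>q\<close>, so multiplying by it and dividing by \<open>q\<close> is the same as dividing by
  it.\<close>

lemma K_1_eq:
  assumes "gauss_sum q eta * gauss_sum (q\<^sup>2) chi / of_nat q = J" "J \<noteq> 0"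
  shows "K 1 = of_nat (q - 1) * J"
proof -
  have "gauss_sum q eta \<noteq> 0" using assms by auto
  note sq = gauss_sum_eta_square[OF this]
  have "of_nat (q - 1) * (J * of_nat q) = gauss_sum q eta * (of_nat (q - 1) * gauss_sum (q\<^sup>2) chi)"
    using assms(1) q_gt_1 by (auto simp: field_simps)
  also have "\<dots> = K 1 * (gauss_sum q eta * gauss_sum q eta)"
    by (simp only: gauss_sum_q2_eq mult_ac)
  finally show ?thesis
    using q_gt_1 by (simp add: sq)
qed

subsection \<open>Sums along an affine line\<close>

lemma one_plus_nonzero:
  assumes "t \<notin> F" "x \<in> F"
  shows "1 + x * t \<noteq> 0"
proof
  assume eq: "1 + x * t = 0"
  hence "x \<noteq> 0" by auto
  hence "t = - 1 / x" using eq by (simp add: field_simps add_eq_0_iff)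
  with assms show False by auto
qed

text \<open>For \<open>t \<notin> F\<close> the elements \<open>t\<close> and \<open>1 + x * t\<close> represent the cosets of \<open>F - {0}\<close> in the
  multiplicative group, that is, the points of the projective line over \<open>F\<close>.\<close>

lemma sum_projective_line:
  fixes f :: "'a \<Rightarrow> complex"
  assumes t: "t \<notin> F"
    and inv: "\<And>c y. c \<in> F \<Longrightarrow> c \<noteq> 0 \<Longrightarrow> y \<noteq> 0 \<Longrightarrow> f (c * y) = f y"
  shows "(\<Sum>y\<in>UNIV-{0}. f y) = of_nat (q - 1) * (f t + (\<Sum>x\<in>F. f (1 + x * t)))"
proof -
  have t0: "t \<noteq> 0" using t by auto
  define \<phi> where "\<phi> = (\<lambda>(a, b). a + b * t)"
  have inj: "inj_on \<phi> (F \<times> F)"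
  proof (rule inj_onI, clarify)
    fix a b a' b' assume F: "a \<in> F" "b \<in> F" "a' \<in> F" "b' \<in> F" and "\<phi> (a, b) = \<phi> (a', b')"
    hence eq: "(b - b') * t = a' - a" by (simp add: \<phi>_def algebra_simps)
    have "b = b'"
    proof (rule ccontr)
      assume "b \<noteq> b'"
      hence "t = (a' - a) / (b - b')" using eq by (simp add: field_simps)
      with F t show False by auto
    qed
    with eq show "a = a' \<and> b = b'" by simp
  qed
  have "card (\<phi> ` (F \<times> F)) = CARD('a)"
    using inj by (simp add: card_image card_cartesian_product card_GF card_UNIV_eq power2_eq_square)
  hence img: "\<phi> ` (F \<times> F) = UNIV"
    by (intro card_subset_eq) auto
  have sum_UNIV: "(\<Sum>y\<in>UNIV. g y) = (\<Sum>a\<in>F. \<Sum>b\<in>F. g (a + b * t))" for g :: "'a \<Rightarrow> complex"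
    unfolding img[symmetric] sum.reindex[OF inj]
    by (simp add: sum.cartesian_product \<phi>_def case_prod_unfold)
  \<comment> \<open>With value 0 at the origin, invariance holds everywhere and sums over all pairs
    (a, b) can be used.\<close>
  define g where "g y = (if y = 0 then 0 else f y)" for y
  have g_inv: "g (c * y) = g y" if "c \<in> F" "c \<noteq> 0" for c y
    using that inv by (auto simp: g_def)
  have "(\<Sum>y\<in>UNIV-{0}. f y) = (\<Sum>y\<in>UNIV. g y)"
    by (rule sum.mono_neutral_cong_left) (auto simp: g_def)
  also have "\<dots> = (\<Sum>a\<in>F. \<Sum>b\<in>F. g (a + b * t))"
    by (rule sum_UNIV)
  \<comment> \<open>The pairs with a = 0 are multiples of \<open>t\<close>; those with a nonzero are
    scaled to the form \<open>1 + x * t\<close>.\<close>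
  also have "\<dots> = (\<Sum>b\<in>F. g (b * t)) + (\<Sum>a\<in>F-{0}. \<Sum>b\<in>F. g (a + b * t))"
    by (subst sum.remove[of _ 0]) auto
  also have "(\<Sum>b\<in>F. g (b * t)) = (\<Sum>b\<in>F-{0}. g t)"
    by (subst sum.remove[of _ 0]) (auto simp: g_inv, simp add: g_def)
  also have "(\<Sum>a\<in>F-{0}. \<Sum>b\<in>F. g (a + b * t)) = (\<Sum>a\<in>F-{0}. \<Sum>x\<in>F. g (1 + x * t))"
  proof (rule sum.cong[OF refl])
    fix a assume a: "a \<in> F - {0}"
    have "(\<Sum>b\<in>F. g (a + b * t)) = (\<Sum>x\<in>F. g (a + (a * x) * t))"
      using a by (intro sum_GF_mult[symmetric]) auto
    also have "\<dots> = (\<Sum>x\<in>F. g (a * (1 + x * t)))"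
      by (simp add: algebra_simps)
    also have "\<dots> = (\<Sum>x\<in>F. g (1 + x * t))"
      using a by (simp add: g_inv)
    finally show "(\<Sum>b\<in>F. g (a + b * t)) = (\<Sum>x\<in>F. g (1 + x * t))" .
  qed
  also have "(\<Sum>x\<in>F. g (1 + x * t)) = (\<Sum>x\<in>F. f (1 + x * t))"
    using one_plus_nonzero[OF t] by (simp add: g_def)
  also have "g t = f t"
    using t0 by (simp add: g_def)
  finally show ?thesis
    by (simp add: card_Diff_subset card_GF ring_distribs)
qed

text \<open>A factor c from \<open>F - {0}\<close> leaves \<open>chi\<close> and \<open>eta\<close>
  with the same sign, and these two signs cancel.\<close>

lemma K_eq_sum_line:
  assumes "t \<notin> F"
  shows "K a = of_nat (q - 1) *
    (chi t * eta (Tr (a * t)) + (\<Sum>x\<in>F. chi (1 + x * t) * eta (Tr a + x * Tr (a * t))))"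
proof -
  have t0: "t \<noteq> 0" using assms by auto
  define f where "f y = chi y * eta (Tr (a * y))" for y
  have "f (c * y) = f y" if c: "c \<in> F" "c \<noteq> 0" "y \<noteq> 0" for c y
  proof -
    have "f (c * y) = (eta c * eta c) * f y"
      using c Tr_mult[OF c(1), of "a * y"]
      by (simp add: f_def chi_mult eta_eq_chi[symmetric] eta_mult mult_ac)
    thus ?thesis using c by (simp add: eta_square)
  qed
  hence "K a = of_nat (q - 1) * (f t + (\<Sum>x\<in>F. f (1 + x * t)))"
    unfolding K_def f_def[symmetric] by (rule sum_projective_line[OF assms])
  moreover have "f (1 + x * t) = chi (1 + x * t) * eta (Tr a + x * Tr (a * t))" if "x \<in> F" for x
  proof -
    have "Tr (a * (1 + x * t)) = Tr a + Tr (x * (a * t))"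
      by (simp add: distrib_left conj_add mult_ac)
    thus ?thesis by (simp only: f_def Tr_mult[OF that])
  qed
  hence "(\<Sum>x\<in>F. f (1 + x * t)) = (\<Sum>x\<in>F. chi (1 + x * t) * eta (Tr a + x * Tr (a * t)))"
    by (rule sum.cong[OF refl])
  ultimately show ?thesis by (simp only: f_def)
qed

lemma conj_diff_nonzero: "t \<notin> F \<Longrightarrow> t ^ q - t \<noteq> 0"
  by (simp add: GF_def)

text \<open>The functional \<open>y \<mapsto> Tr (a * y)\<close> is chosen to vanish at the point \<open>t\<close>, and in
  \<open>sum_chi_eta_line\<close> at the point \<open>1 + s * t\<close>.\<close>

lemma sum_chi_line:
  assumes t: "t \<notin> F" and K: "K 1 = of_nat (q - 1) * J"
  shows "(\<Sum>x\<in>F. chi (1 + x * t)) = J * chi (t ^ q - t) / chi t"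
proof -
  define d where "d = t ^ q - t"
  have d: "d \<noteq> 0" "d ^ q = - d"
    using conj_diff_nonzero[OF t] by (auto simp: d_def conj_diff conj_conj)
  have t0: "t \<noteq> 0" using t by auto
  \<comment> \<open>The product \<open>a * t\<close> is a norm divided by \<open>d\<close>, and
    conjugation negates \<open>d\<close>, so its trace is 0. The argument of \<open>eta\<close>
    becomes constantly 1.\<close>
  define a where "a = t ^ q / d"
  have a0: "a \<noteq> 0" using d t0 by (simp add: a_def)
  have Tr_a: "Tr a = 1" "Tr (a * t) = 0"
    using d by (auto simp: a_def power_divide power_mult_distrib conj_conj divide_simps)
               (auto simp: d_def)
  have "of_nat (q - 1) * (J / chi a) = of_nat (q - 1) * (\<Sum>x\<in>F. chi (1 + x * t))"
    using K_eq_sum_line[OF t, of a] K_eq[OF a0] eta_eq_chi[of 1] by (simp add: Tr_a K)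
  hence "(\<Sum>x\<in>F. chi (1 + x * t)) = J / chi a"
    using q_gt_1 by (subst (asm) mult_left_cancel) auto
  also have "chi a = chi t / chi d"
    using d t0 by (simp add: a_def chi_divide chi_conj)
  finally show ?thesis by (simp add: d_def)
qed

lemma sum_chi_eta_line:
  assumes t: "t \<notin> F" and s: "s \<in> F" and K: "K 1 = of_nat (q - 1) * J"
  shows "(\<Sum>x\<in>F. chi (1 + x * t) * eta (x - s)) = J * chi (t ^ q - t) / chi (1 + s * t) - chi t"
proof -
  define d where "d = t ^ q - t"
  have d: "d \<noteq> 0" "d ^ q = - d"
    using conj_diff_nonzero[OF t] by (auto simp: d_def conj_diff conj_conj)
  have y0: "1 + s * t \<noteq> 0" using t s by (rule one_plus_nonzero)
  \<comment> \<open>Now the trace of \<open>a * (1 + s * t)\<close> is 0, and the sign makes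
    \<open>Tr (a * t)\<close> equal to 1. The argument of \<open>eta\<close> becomes
    \<open>x - s\<close>, and the point \<open>t\<close> contributes the extra
    \<open>chi t\<close>.\<close>
  define a where "a = - ((1 + s * t) ^ q / d)"
  have a0: "a \<noteq> 0" using d y0 by (simp add: a_def)
  have s': "s ^ q = s" using s by (simp add: GF_def)
  have Tr_a: "Tr a = - s" "Tr (a * t) = 1"
    using d s' by (auto simp: a_def power_divide power_mult_distrib conj_minus conj_conj conj_add divide_simps)
                  (auto simp: d_def algebra_simps)
  have "of_nat (q - 1) * (J / chi a) = of_nat (q - 1) * (chi t + (\<Sum>x\<in>F. chi (1 + x * t) * eta (x - s)))"
    using K_eq_sum_line[OF t, of a] K_eq[OF a0] eta_eq_chi[of 1] by (simp add: Tr_a K)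
  hence "(\<Sum>x\<in>F. chi (1 + x * t) * eta (x - s)) = J / chi a - chi t"
    using q_gt_1 by (subst (asm) mult_left_cancel) auto
  also have "chi a = chi (1 + s * t) / chi d"
    using d y0 by (simp add: a_def chi_minus chi_divide chi_conj)
  finally show ?thesis by (simp add: d_def)
qed

text \<open>Multiplication by \<open>w\<close> negates the square of \<open>chi\<close>, so the full
  sum is 0; on \<open>F - {0}\<close> that square is 1, so the sum descends to the projective
  line.\<close>

lemma sum_chi_square_line:
  assumes t: "t \<notin> F"
  shows "(\<Sum>x\<in>F. (chi (1 + x * t))\<^sup>2) = - (chi t)\<^sup>2"
proof -
  have "(\<Sum>y\<in>UNIV-{0}. (chi y)\<^sup>2) = (\<Sum>y\<in>UNIV-{0}. (chi (w * y))\<^sup>2)"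
    by (rule sum.reindex_bij_witness[of _ "\<lambda>y. w * y" "\<lambda>y. y / w"]) (use w_nonzero in auto)
  also have "\<dots> = - (\<Sum>y\<in>UNIV-{0}. (chi y)\<^sup>2)"
    using w_nonzero by (simp add: chi_mult chi_w power_mult_distrib sum_negf)
  finally have "(\<Sum>y\<in>UNIV-{0}. (chi y)\<^sup>2) = 0" by simp
  moreover have "(chi (c * y))\<^sup>2 = (chi y)\<^sup>2" if "c \<in> F" "c \<noteq> 0" "y \<noteq> 0" for c y
    using that eta_square[of c] by (simp add: chi_mult eta_eq_chi power_mult_distrib power2_eq_square)
  hence "(\<Sum>y\<in>UNIV-{0}. (chi y)\<^sup>2)
      = of_nat (q - 1) * ((chi t)\<^sup>2 + (\<Sum>x\<in>F. (chi (1 + x * t))\<^sup>2))"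
    by (rule sum_projective_line[OF t])
  ultimately show ?thesis
    using q_gt_1 by (simp add: add_eq_0_iff)
qed

subsection \<open>Counting\<close>

lemma card_Int_translate:
  assumes "D \<subseteq> F"
  shows "real (card (D \<inter> translate A s)) = (\<Sum>x\<in>F. of_bool (x \<in> D) * of_bool (x - s \<in> A))"
proof -
  have mem: "x \<in> translate A s \<longleftrightarrow> x - s \<in> A" for x
    by (auto simp: translate_def image_iff) (metis diff_add_cancel)
  have "real (card (D \<inter> translate A s)) = (\<Sum>x\<in>D \<inter> translate A s. 1)" by simp
  also have "\<dots> = (\<Sum>x\<in>F. of_bool (x \<in> D) * of_bool (x - s \<in> A))"
    using assms by (intro sum.mono_neutral_cong_left) (auto simp: mem)
  finally show ?thesis .
qed

lemma of_bool_squares: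
  assumes "y \<in> F"
  shows "of_bool (y \<in> nonzero_squares q) = (1 + Re (eta y) - of_bool (y = 0)) / (2::real)"
    and "of_bool (y \<in> nonzero_squares q \<union> {0}) = (1 + Re (eta y) + of_bool (y = 0)) / (2::real)"
    and "of_bool (y \<in> F - {0} - nonzero_squares q) = (1 - Re (eta y) - of_bool (y = 0)) / (2::real)"
  using assms nonzero_squares_subset by (auto simp: quadratic_char_def)

text \<open>\<open>U\<close> stands for \<open>chi\<close> along the line, divided by
  \<open>\<i> powi h\<close>. Leaving it abstract allows the reflected function to be used when
  \<open>\<epsilon> * \<delta> = -1\<close>.\<close>

lemma value_sets:
  fixes m :: int and U :: "'a \<Rightarrow> complex"
  assumes q: "int q = 2 * m\<^sup>2 + 2 * m + 1"
    and U: "\<And>x. x \<in> F \<Longrightarrow> U x \<in> {1, \<i>, -1, -\<i>}"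
    and sum_U: "(\<Sum>x\<in>F. U x) = - (of_int m + of_int (m + 1) * \<i>)"
    and sum_U2: "(\<Sum>x\<in>F. (U x)\<^sup>2) = 1"
    and sum_U_eta: "\<And>s. s \<in> F \<Longrightarrow>
      (\<Sum>x\<in>F. U x * eta (x - s)) = \<i> * (of_int m + of_int (m + 1) * \<i>) / U s + \<i>"
  defines "D0 \<equiv> {x \<in> F. U x \<in> {1, \<i>}}" and "D1 \<equiv> {x \<in> F. U x \<in> {\<i>, -1}}"
  shows "int (card D0) = m\<^sup>2 \<and> int (card D1) = m\<^sup>2 + m
    \<and> {int (card (D0 \<inter> translate (nonzero_squares q \<union> {0}) s))
         + int (card (D1 \<inter> translate (nonzero_squares q) s)) |s. s \<in> F} = {m\<^sup>2, m\<^sup>2 + m + 1}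
    \<and> {int (card (D0 \<inter> translate (nonzero_squares q) s))
         + int (card (D1 \<inter> translate (F - {0} - nonzero_squares q) s)) |s. s \<in> F}
        = {m\<^sup>2 - 1, m\<^sup>2, m\<^sup>2 + m - 1, m\<^sup>2 + m}"
proof -
  define M where "M = real_of_int m"
  define a where "a x = Re (U x)" for x
  define b where "b x = Im (U x)" for x
  define e where "e y = Re (eta y)" for y
  have qM: "real q = 2 * M\<^sup>2 + 2 * M + 1"
    using arg_cong[OF q, of real_of_int] by (simp add: M_def)
  have eta_real: "eta y = of_real (e y)" for y
    by (simp add: e_def quadratic_char_def)
  have sum_e: "(\<Sum>x\<in>F. e (x - s)) = 0" if "s \<in> F" for s
  proof -
    have "(\<Sum>x\<in>F. e (x - s)) = (\<Sum>x\<in>F. e x)"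
      using sum_GF_add[of "- s" e] that by simp
    also have "\<dots> = 0" using arg_cong[OF sum_eta, of Re] by (simp add: e_def)
    finally show ?thesis .
  qed
  have sum_a: "(\<Sum>x\<in>F. a x) = - M" and sum_b: "(\<Sum>x\<in>F. b x) = - (M + 1)"
    using arg_cong[OF sum_U, of Re] arg_cong[OF sum_U, of Im] by (simp_all add: a_def b_def M_def)
  have ab: "(a x)\<^sup>2 + (b x)\<^sup>2 = 1" if "x \<in> F" for x
    using U[OF that] by (auto simp: a_def b_def)
  \<comment> \<open>The modulus of \<open>U\<close> gives the sum, and the real part of its square
    the difference, of the two second moments.\<close>
  have "(\<Sum>x\<in>F. (a x)\<^sup>2) + (\<Sum>x\<in>F. (b x)\<^sup>2) = real q"
    using ab by (simp add: card_GF flip: sum.distrib)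
  moreover have "(\<Sum>x\<in>F. (a x)\<^sup>2) - (\<Sum>x\<in>F. (b x)\<^sup>2) = 1"
    using arg_cong[OF sum_U2, of Re]
    by (simp add: a_def b_def power2_eq_square sum_subtractf)
  ultimately have sum_a2: "(\<Sum>x\<in>F. (a x)\<^sup>2) = M\<^sup>2 + M + 1" and sum_b2: "(\<Sum>x\<in>F. (b x)\<^sup>2) = M\<^sup>2 + M"
    using qM by auto
  \<comment> \<open>For a fourth root of unity the inverse is the conjugate, so the right-hand sides
    are linear in \<open>a s\<close> and \<open>b s\<close>.\<close>
  have sum_ae: "(\<Sum>x\<in>F. a x * e (x - s)) = - (M + 1) * a s + M * b s"
    and sum_be: "(\<Sum>x\<in>F. b x * e (x - s)) = M * a s + (M + 1) * b s + 1" if "s \<in> F" for s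
    using U[OF that] arg_cong[OF sum_U_eta[OF that], of Re] arg_cong[OF sum_U_eta[OF that], of Im]
    by (auto simp: a_def b_def eta_real M_def)

  \<comment> \<open>On fourth roots of unity a + b is 1 at 1 and \<open>\<i>\<close> and -1 at the
    other two; c = -1 reflects this to the pair \<open>\<i>\<close>, -1.\<close>
  define d where "d c x = (1 + c * a x + b x) / 2" for c x
  have D0: "of_bool (x \<in> D0) = d 1 x" and D1: "of_bool (x \<in> D1) = d (-1) x" if "x \<in> F" for x
    using U[OF that] that by (auto simp: D0_def D1_def d_def a_def b_def complex_eq_iff)
  have D_sub: "D0 \<subseteq> F" "D1 \<subseteq> F" by (auto simp: D0_def D1_def)
  have sum_d: "(\<Sum>x\<in>F. d c x) = (real q - c * M - (M + 1)) / 2" for c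
    by (simp add: d_def sum.distrib sum_a sum_b card_GF flip: sum_divide_distrib sum_distrib_left)
  have sum_de: "(\<Sum>x\<in>F. d c x * e (x - s))
      = (c * (- (M + 1) * a s + M * b s) + (M * a s + (M + 1) * b s + 1)) / 2" if "s \<in> F" for c s
  proof -
    have "(\<Sum>x\<in>F. d c x * e (x - s))
        = (\<Sum>x\<in>F. (e (x - s) + c * (a x * e (x - s)) + b x * e (x - s)) / 2)"
      by (simp add: d_def algebra_simps)
    also have "\<dots> = ((\<Sum>x\<in>F. e (x - s)) + c * (\<Sum>x\<in>F. a x * e (x - s))
        + (\<Sum>x\<in>F. b x * e (x - s))) / 2"
      by (simp add: sum.distrib sum_distrib_left flip: sum_divide_distrib)
    finally show ?thesis by (simp only: sum_e[OF that] sum_ae[OF that] sum_be[OF that] add_0_left)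
  qed
  \<comment> \<open>The sign \<open>\<sigma>\<close> chooses squares or nonsquares, and
    \<open>\<tau>\<close> includes or excludes 0, following \<open>of_bool_squares\<close>.\<close>
  have sum_d_weight: "(\<Sum>x\<in>F. d c x * ((1 + \<sigma> * e (x - s) + \<tau> * of_bool (x - s = 0)) / 2))
      = ((\<Sum>x\<in>F. d c x) + \<sigma> * (\<Sum>x\<in>F. d c x * e (x - s)) + \<tau> * d c s) / 2"
    if "s \<in> F" for c s \<sigma> \<tau>
  proof -
    have "(\<Sum>x\<in>F. d c x * of_bool (x - s = 0)) = d c s"
      using that by (simp add: of_bool_def if_distrib cong: if_cong)
    moreover have "(\<Sum>x\<in>F. d c x * ((1 + \<sigma> * e (x - s) + \<tau> * of_bool (x - s = 0)) / 2))
      = (\<Sum>x\<in>F. (d c x + \<sigma> * (d c x * e (x - s)) + \<tau> * (d c x * of_bool (x - s = 0))) / 2)"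
      by (simp add: algebra_simps)
    ultimately show ?thesis
      by (simp add: sum.distrib flip: sum_divide_distrib sum_distrib_left)
  qed

  have "real (card D0) = (\<Sum>x\<in>F. d 1 x)" "real (card D1) = (\<Sum>x\<in>F. d (-1) x)"
  proof -
    have "real (card D) = (\<Sum>x\<in>F. of_bool (x \<in> D))" if "D \<subseteq> F" for D
      using that by (simp add: Int_absorb1)
    from this[OF D_sub(1)] this[OF D_sub(2)]
    show "real (card D0) = (\<Sum>x\<in>F. d 1 x)" "real (card D1) = (\<Sum>x\<in>F. d (-1) x)"
      by (simp_all add: D0 D1 cong: sum.cong)
  qed
  hence "real_of_int (int (card D0)) = real_of_int (m\<^sup>2)"
    "real_of_int (int (card D1)) = real_of_int (m\<^sup>2 + m)"
    by (simp_all add: sum_d qM M_def)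
  hence card_D: "int (card D0) = m\<^sup>2" "int (card D1) = m\<^sup>2 + m"
    by (simp_all only: of_int_eq_iff)

  define V where "V s = int (card (D0 \<inter> translate (nonzero_squares q \<union> {0}) s))
         + int (card (D1 \<inter> translate (nonzero_squares q) s))" for s
  define W where "W s = int (card (D0 \<inter> translate (nonzero_squares q) s))
         + int (card (D1 \<inter> translate (F - {0} - nonzero_squares q) s))" for s
  have V_eq: "real_of_int (V s) = (2 * M\<^sup>2 + M + 1 + (M + 1) * (a s + b s)) / 2"
    and W_eq: "real_of_int (W s) = (2 * M\<^sup>2 + M - 1 - (M + 1) * a s + (M - 1) * b s) / 2"
    if s: "s \<in> F" for s
  proof -
    have 1: "real (card (D0 \<inter> translate (nonzero_squares q \<union> {0}) s))
        = (\<Sum>x\<in>F. d 1 x * ((1 + 1 * e (x - s) + 1 * of_bool (x - s = 0)) / 2))"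
      unfolding card_Int_translate[OF D_sub(1)] using s
      by (intro sum.cong refl) (simp only: D0 of_bool_squares GF_simps e_def mult_1_left)
    have 2: "real (card (D1 \<inter> translate (nonzero_squares q) s))
        = (\<Sum>x\<in>F. d (-1) x * ((1 + 1 * e (x - s) + (-1) * of_bool (x - s = 0)) / 2))"
      unfolding card_Int_translate[OF D_sub(2)] using s
      by (intro sum.cong refl) (simp only: D1 of_bool_squares GF_simps e_def, simp)
    have 3: "real (card (D0 \<inter> translate (nonzero_squares q) s))
        = (\<Sum>x\<in>F. d 1 x * ((1 + 1 * e (x - s) + (-1) * of_bool (x - s = 0)) / 2))"
      unfolding card_Int_translate[OF D_sub(1)] using s
      by (intro sum.cong refl) (simp only: D0 of_bool_squares GF_simps e_def, simp)
    have 4: "real (card (D1 \<inter> translate (F - {0} - nonzero_squares q) s))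
        = (\<Sum>x\<in>F. d (-1) x * ((1 + (-1) * e (x - s) + (-1) * of_bool (x - s = 0)) / 2))"
      unfolding card_Int_translate[OF D_sub(2)] using s
      by (intro sum.cong refl) (simp only: D1 of_bool_squares GF_simps e_def, simp)
    show "real_of_int (V s) = (2 * M\<^sup>2 + M + 1 + (M + 1) * (a s + b s)) / 2"
      unfolding V_def of_int_add of_int_of_nat_eq 1 2 sum_d_weight[OF s] sum_de[OF s] sum_d qM
      by (simp add: d_def field_simps)
    show "real_of_int (W s) = (2 * M\<^sup>2 + M - 1 - (M + 1) * a s + (M - 1) * b s) / 2"
      unfolding W_def of_int_add of_int_of_nat_eq 3 4 sum_d_weight[OF s] sum_de[OF s] sum_d qM
      by (simp add: d_def field_simps)
  qed
  have V: "V s = (if U s \<in> {1, \<i>} then m\<^sup>2 + m + 1 else m\<^sup>2)"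
    and W: "W s = (if U s = 1 then m\<^sup>2 - 1 else if U s = \<i> then m\<^sup>2 + m - 1
                  else if U s = -1 then m\<^sup>2 + m else m\<^sup>2)" if s: "s \<in> F" for s
  proof -
    have "real_of_int (V s) = real_of_int (if U s \<in> {1, \<i>} then m\<^sup>2 + m + 1 else m\<^sup>2)"
      using U[OF s] by (auto simp: V_eq[OF s] a_def b_def M_def complex_eq_iff field_simps)
    thus "V s = (if U s \<in> {1, \<i>} then m\<^sup>2 + m + 1 else m\<^sup>2)" by (simp only: of_int_eq_iff)
    have "real_of_int (W s) = real_of_int (if U s = 1 then m\<^sup>2 - 1 else if U s = \<i> then m\<^sup>2 + m - 1
                  else if U s = -1 then m\<^sup>2 + m else m\<^sup>2)"
      using U[OF s] by (auto simp: W_eq[OF s] a_def b_def M_def complex_eq_iff field_simps)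
    thus "W s = (if U s = 1 then m\<^sup>2 - 1 else if U s = \<i> then m\<^sup>2 + m - 1
                  else if U s = -1 then m\<^sup>2 + m else m\<^sup>2)" by (simp only: of_int_eq_iff)
  qed

  \<comment> \<open>For \<open>m = -1\<close> the formula would give \<open>q = 1\<close>.\<close>
  have m_cases: "m \<noteq> -1" using q q_gt_1 by auto
  hence M1: "(M + 1)\<^sup>2 > 0" by (simp add: M_def)
  \<comment> \<open>Each \<open>g\<close> used below is 2 where \<open>U\<close> equals
    \<open>u\<close> and 0 at the other three roots of unity, so its sum is twice the class
    size.\<close>
  have ex: "\<exists>x\<in>F. U x = u"
    if "\<And>x. x \<in> F \<Longrightarrow> U x \<noteq> u \<Longrightarrow> g x = 0" "(\<Sum>x\<in>F. g x) \<noteq> 0" for u and g :: "'a \<Rightarrow> real"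
    using that sum.neutral[of F g] by blast
  obtain x1 where x1: "x1 \<in> F" "U x1 = 1"
  proof -
    have "(\<Sum>x\<in>F. (a x)\<^sup>2 + a x) = M\<^sup>2 + 1" by (simp add: sum.distrib sum_a sum_a2)
    also have "\<dots> \<noteq> 0" by (metis add_nonneg_eq_0_iff zero_le_power2 zero_le_one zero_neq_one)
    finally show thesis
      using ex[of 1 "\<lambda>x. (a x)\<^sup>2 + a x"] U that by (fastforce simp: a_def)
  qed
  obtain x2 where x2: "x2 \<in> F" "U x2 = -1"
  proof -
    have "(\<Sum>x\<in>F. (a x)\<^sup>2 - a x) = (M + 1)\<^sup>2"
      by (simp add: sum_subtractf sum_a sum_a2 power2_sum)
    with M1 have "(\<Sum>x\<in>F. (a x)\<^sup>2 - a x) \<noteq> 0" by simp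
    thus thesis
      using ex[of "-1" "\<lambda>x. (a x)\<^sup>2 - a x"] U that by (fastforce simp: a_def)
  qed
  obtain x3 where x3: "x3 \<in> F" "U x3 = -\<i>"
  proof -
    have "(\<Sum>x\<in>F. (b x)\<^sup>2 - b x) = (M + 1)\<^sup>2"
      by (simp add: sum_subtractf sum_b sum_b2 power2_sum)
    with M1 have "(\<Sum>x\<in>F. (b x)\<^sup>2 - b x) \<noteq> 0" by simp
    thus thesis
      using ex[of "-\<i>" "\<lambda>x. (b x)\<^sup>2 - b x"] U that by (fastforce simp: b_def)
  qed
  text \<open>The value \<open>\<i>\<close> is taken \<open>(m\<^sup>2 - 1) / 2\<close> times, hence not at all for \<open>m = 1\<close>; but then the
    value of \<open>W\<close> it would contribute is also attained at \<open>x3\<close>.\<close>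
  have m2: "\<exists>x\<in>F. W x = m\<^sup>2 + m - 1"
  proof (cases "m = 1")
    case True
    thus ?thesis using x3 W[OF x3(1)] by (intro bexI[of _ x3]) (auto simp: complex_eq_iff)
  next
    case False
    have "(\<Sum>x\<in>F. (b x)\<^sup>2 + b x) = M\<^sup>2 - 1"
      by (simp add: sum.distrib sum_b sum_b2)
    moreover have "M\<^sup>2 \<noteq> 1" using False m_cases by (simp add: M_def power2_eq_1_iff)
    ultimately have "(\<Sum>x\<in>F. (b x)\<^sup>2 + b x) \<noteq> 0" by simp
    hence "\<exists>x\<in>F. U x = \<i>"
      using ex[of \<i> "\<lambda>x. (b x)\<^sup>2 + b x"] U by (fastforce simp: b_def)
    then obtain x where "x \<in> F" "U x = \<i>" by blast
    thus ?thesis using W[of x] by (intro bexI[of _ x]) (auto simp: complex_eq_iff)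
  qed
  have "V ` F = {m\<^sup>2, m\<^sup>2 + m + 1}"
  proof
    show "V ` F \<subseteq> {m\<^sup>2, m\<^sup>2 + m + 1}" using V by auto
    have "V x1 = m\<^sup>2 + m + 1" "V x2 = m\<^sup>2"
      using V[OF x1(1)] V[OF x2(1)] x1 x2 by (auto simp: complex_eq_iff)
    thus "{m\<^sup>2, m\<^sup>2 + m + 1} \<subseteq> V ` F"
      using imageI[OF x1(1), of V] imageI[OF x2(1), of V] by simp
  qed
  moreover have "W ` F = {m\<^sup>2 - 1, m\<^sup>2, m\<^sup>2 + m - 1, m\<^sup>2 + m}"
  proof
    show "W ` F \<subseteq> {m\<^sup>2 - 1, m\<^sup>2, m\<^sup>2 + m - 1, m\<^sup>2 + m}" using W by auto
    have "W x1 = m\<^sup>2 - 1" "W x2 = m\<^sup>2 + m" "W x3 = m\<^sup>2"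
      using W[OF x1(1)] W[OF x2(1)] W[OF x3(1)] x1 x2 x3 by (auto simp: complex_eq_iff)
    moreover obtain x4 where "x4 \<in> F" "W x4 = m\<^sup>2 + m - 1" using m2 by blast
    ultimately show "{m\<^sup>2 - 1, m\<^sup>2, m\<^sup>2 + m - 1, m\<^sup>2 + m} \<subseteq> W ` F"
      using imageI[OF x1(1), of W] imageI[OF x2(1), of W] imageI[OF x3(1), of W] imageI[of x4 F W]
      by simp
  qed
  ultimately show ?thesis
    using card_D unfolding V_def W_def by (simp only: Setcompr_eq_image simp_thms)
qed

end

lemma i_powi_mod_4: "\<i> powi (k mod 4) = \<i> powi k"
proof -
  have "\<i> powi k = \<i> powi (4 * (k div 4) + k mod 4)" by simp
  also have "\<dots> = (\<i> powi 4) powi (k div 4) * \<i> powi (k mod 4)"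
    by (simp only: power_int_add_numeral power_int_mult power_int_add[OF disjI1[OF complex_i_not_zero]])
  finally show ?thesis by simp
qed

theorem theorem5p4:
  fixes m :: int and q :: nat
    and \<omega> :: "'a::{field,finite}" and chi4 :: "'a \<Rightarrow> complex"
    and \<epsilon> \<delta> h l :: int and H\<^sub>0 H\<^sub>1 :: "int set"
  assumes "odd m"
    and "int q = 2 * m\<^sup>2 + 2 * m + 1"
    and "primepow q"
    and "CARD('a) = q\<^sup>2"
    and "primitive_element \<omega>"
    and "mult_character chi4" and "chi4 \<omega> = \<i>"
    and "\<epsilon> \<in> {1, -1}" and "\<delta> \<in> {1, -1}"
    and "gauss_sum q (quadratic_char q :: 'a \<Rightarrow> complex) * gauss_sum (q\<^sup>2) chi4 / of_nat q
           = of_int (\<epsilon> * m) + of_int (\<delta> * (m + 1)) * \<i>"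
    and "h \<in> {0, 1, 2, 3}"
    and "\<not> (int q + 1) dvd l"
    and "chi4 (\<omega> powi l) = \<i> powi (3 + h)"
    and "chi4 (\<omega> powi (l * int q) - \<omega> powi l) = \<i> powi (\<delta> * (1 + 2 * h))"
    and "(H\<^sub>0, H\<^sub>1) =
           (if \<epsilon> * \<delta> = 1 then ({h mod 4, (h + 1) mod 4}, {(h + 1) mod 4, (h + 2) mod 4})
            else ({(h + 1) mod 4, (h + 2) mod 4}, {h mod 4, (h + 1) mod 4}))"
  shows "int (card (D_set q \<omega> l H\<^sub>0)) = m\<^sup>2
    \<and> int (card (D_set q \<omega> l H\<^sub>1)) = m\<^sup>2 + m
    \<and> {int (card (D_set q \<omega> l H\<^sub>0 \<inter> translate (nonzero_squares q \<union> {0}) s))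
         + int (card (D_set q \<omega> l H\<^sub>1 \<inter> translate (nonzero_squares q) s)) |s. s \<in> GF q}
        = {m\<^sup>2, m\<^sup>2 + m + 1}
    \<and> {int (card (D_set q \<omega> l H\<^sub>0 \<inter> translate (nonzero_squares q) s))
         + int (card (D_set q \<omega> l H\<^sub>1 \<inter> translate (GF q - {0} - nonzero_squares q) s)) |s. s \<in> GF q}
        = {m\<^sup>2 - 1, m\<^sup>2, m\<^sup>2 + m - 1, m\<^sup>2 + m}"
proof -
  have q4: "q mod 4 = 1"
  proof -
    obtain k where "m = 2 * k + 1" using \<open>odd m\<close> by (rule oddE)
    hence "int q = 4 * (2 * k\<^sup>2 + 3 * k + 1) + 1"
      using assms(2) by (simp add: power2_eq_square algebra_simps)
    thus ?thesis by presburger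
  qed
  interpret quartic_character q \<omega> chi4
    by unfold_locales (use q4 assms in auto)
  define t where "t = \<omega> powi l"
  define z where "z = \<i> powi h"
  define e where "e = \<epsilon> * \<delta>"
  define J :: complex where "J = of_int (\<epsilon> * m) + of_int (\<delta> * (m + 1)) * \<i>"
  \<comment> \<open>The sign \<open>\<delta>\<close> also occurs in \<open>chi_d\<close>;
    multiplying \<open>J\<close> by it leaves a value that depends on the signs only through
    \<open>e\<close>.\<close>
  define J' :: complex where "J' = of_int (e * m) + of_int (m + 1) * \<i>"
  have e: "e \<in> {1, -1}" using assms(8,9) by (auto simp: e_def)
  have J': "of_int \<delta> * J = J'"
    using assms(8,9) by (auto simp: J_def J'_def e_def algebra_simps)
  have z: "z \<in> {1, \<i>, -1, -\<i>}"
    using assms(11) by (auto simp: z_def power_int_def numeral_eq_Suc)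
  hence z0: "z \<noteq> 0" by auto
  have tF: "t \<notin> F"
  proof
    assume "t \<in> F"
    hence "\<omega> powi (l * int q) = \<omega> powi l"
      by (simp add: t_def GF_def power_int_mult)
    moreover have "l * int q = l * (int q - 1) + l" by (simp add: algebra_simps)
    ultimately have "\<omega> powi (l * (int q - 1)) = 1"
      using w_nonzero by (simp add: power_int_add)
    hence "int (q\<^sup>2 - 1) dvd l * (int q - 1)" by (rule w_powi_eq_1D)
    also have "int (q\<^sup>2 - 1) = (int q + 1) * (int q - 1)"
      using q_gt_1 by (simp add: of_nat_diff power2_eq_square algebra_simps)
    finally have "int q + 1 dvd l" using q_gt_1 by simp
    with assms(12) show False by simp
  qed
  have chi_t: "chi4 t = - \<i> * z"
    using assms(13) by (simp add: t_def z_def power_int_add power3_eq_cube)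
  \<comment> \<open>The exponent is odd apart from its sign, and negating an odd exponent negates
    the power of \<open>\<i>\<close>, so \<open>\<delta>\<close> becomes a factor.\<close>
  have chi_d: "chi4 (t ^ q - t) = of_int \<delta> * \<i> * z\<^sup>2"
  proof -
    have "chi4 (t ^ q - t) = \<i> powi (\<delta> * (1 + 2 * h))"
      using assms(14) by (simp add: t_def power_int_mult)
    thus ?thesis
      using assms(9,11) by (auto simp: z_def power_int_def numeral_eq_Suc)
  qed
  have "m \<noteq> 0" using assms(1) by auto
  hence "J \<noteq> 0" using assms(8) by (auto simp: J_def complex_eq_iff)
  with assms(10) have K: "K 1 = of_nat (q - 1) * J"
    unfolding J_def by (intro K_1_eq)

  \<comment> \<open>Dividing by \<open>z\<close> removes \<open>h\<close>: the index pairs become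
    fixed pairs of roots of unity, and \<open>chi4 t\<close> becomes \<open>- \<i>\<close>.\<close>
  define U where "U x = chi4 (1 + x * t) / z" for x
  have U_cases: "U x \<in> {1, \<i>, -1, -\<i>}" if "x \<in> F" for x
    using chi_cases[OF one_plus_nonzero[OF tF that]] z by (auto simp: U_def)
  have sum_U: "(\<Sum>x\<in>F. U x) = - J'"
    unfolding U_def sum_divide_distrib[symmetric] sum_chi_line[OF tF K] chi_t chi_d J'[symmetric]
    using z0 by (simp add: field_simps power2_eq_square)
  have sum_U2: "(\<Sum>x\<in>F. (U x)\<^sup>2) = 1"
    unfolding U_def power_divide sum_divide_distrib[symmetric] sum_chi_square_line[OF tF] chi_t
    using z0 by (simp add: power_mult_distrib)
  have sum_U_eta: "(\<Sum>x\<in>F. U x * eta (x - s)) = \<i> * J' / U s + \<i>" if s: "s \<in> F" for s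
  proof -
    have "(\<Sum>x\<in>F. U x * eta (x - s)) = (\<Sum>x\<in>F. chi4 (1 + x * t) * eta (x - s)) / z"
      by (simp add: U_def sum_divide_distrib)
    also have "\<dots> = \<i> * J' / U s + \<i>"
      unfolding sum_chi_eta_line[OF tF s K] chi_t chi_d J'[symmetric] U_def
      using z0 chi_nonzero[OF one_plus_nonzero[OF tF s]] by (simp add: field_simps power2_eq_square)
    finally show ?thesis .
  qed

  have pows: "\<i> powi (h mod 4) = z" "\<i> powi ((h + 1) mod 4) = \<i> * z" "\<i> powi ((h + 2) mod 4) = - z"
    by (simp_all add: i_powi_mod_4 power_int_add z_def)
  have D_set_iff: "D_set q \<omega> l {j, k} = {x \<in> F. chi4 (1 + x * t) \<in> {\<i> powi j, \<i> powi k}}" for j k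
    using mem_cyclotomic_class_iff[OF one_plus_nonzero[OF tF]]
    unfolding D_set_def t_def[symmetric] by auto
  have D_low: "D_set q \<omega> l {h mod 4, (h + 1) mod 4} = {x \<in> F. U x \<in> {1, \<i>}}"
    and D_high: "D_set q \<omega> l {(h + 1) mod 4, (h + 2) mod 4} = {x \<in> F. U x \<in> {\<i>, -1}}"
    unfolding D_set_iff pows U_def using z0 by (auto simp: field_simps)

  show ?thesis
  proof (cases "e = 1")
    case True
    hence "H\<^sub>0 = {h mod 4, (h + 1) mod 4}" "H\<^sub>1 = {(h + 1) mod 4, (h + 2) mod 4}"
      using assms(15) by (auto simp: e_def)
    thus ?thesis
      using value_sets[OF assms(2) U_cases] sum_U sum_U2 sum_U_eta True
      by (simp only: D_low D_high J'_def mult_1_left)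
  next
    case False
    with e have e': "e = -1" by simp
    hence H: "H\<^sub>0 = {(h + 1) mod 4, (h + 2) mod 4}" "H\<^sub>1 = {h mod 4, (h + 1) mod 4}"
      using assms(15) by (auto simp: e_def)
    \<comment> \<open>Reflection in the imaginary axis exchanges the two cases.\<close>
    define U' where "U' x = - cnj (U x)" for x
    have cnj_J': "- cnj J' = of_int m + of_int (m + 1) * \<i>"
      by (simp add: J'_def e')
    have cnj_eta: "cnj (eta y) = eta y" for y
      by (simp add: quadratic_char_def)
    have U'_cases: "U' x \<in> {1, \<i>, -1, -\<i>}" if "x \<in> F" for x
      using U_cases[OF that] by (auto simp: U'_def)
    have "(\<Sum>x\<in>F. U' x) = - (of_int m + of_int (m + 1) * \<i>)"
      unfolding cnj_J'[symmetric] using arg_cong[OF sum_U, of cnj] by (simp add: U'_def sum_negf)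
    moreover have "(\<Sum>x\<in>F. (U' x)\<^sup>2) = 1"
      using arg_cong[OF sum_U2, of cnj] by (simp add: U'_def)
    \<comment> \<open>The map c to \<open>- cnj c\<close> fixes \<open>\<i>\<close> and reflects
      \<open>J'\<close> and \<open>U\<close> alike, so the shape of the formula is
      preserved.\<close>
    moreover have "(\<Sum>x\<in>F. U' x * eta (x - s))
        = \<i> * (of_int m + of_int (m + 1) * \<i>) / U' s + \<i>" if "s \<in> F" for s
      unfolding cnj_J'[symmetric] using arg_cong[OF sum_U_eta[OF that], of "\<lambda>c. - cnj c"]
      by (simp add: U'_def cnj_eta sum_negf)
    moreover have "D_set q \<omega> l H\<^sub>0 = {x \<in> F. U' x \<in> {1, \<i>}}" "D_set q \<omega> l H\<^sub>1 = {x \<in> F. U' x \<in> {\<i>, -1}}"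
      unfolding H D_low D_high by (auto simp: U'_def complex_eq_iff)
    ultimately show ?thesis
      using value_sets[OF assms(2) U'_cases] by simp
  qed
qed

end
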